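(* Let $\Lambda$ be a $\Lambda$-sequence and let $f\in\Lambda BV$. Then for every natural number $n\ge 1$, $V_\Lambda(B_nf)\leq V_\Lambda(f)$.
   Context: A $\Lambda$-sequence is a nondecreasing sequence $\Lambda=(\lambda_k)_{k\ge 1}$ of positive reals with $\sum_k \frac{1}{\lambda_k}=\infty$. For a closed interval $I=[a,b]\subseteq[0,1]$ and $f:[0,1]\to\mathbb{R}$ write $|f(I)|=|f(b)-f(a)|$. Closed intervals are nonoverlapping if any two of them intersect at most at endpoints. For a finite sequence $\mathcal{I}=\langle I_1,\dots,I_m\rangle$ (in any order) of nonoverlapping closed intervals contained in $[0,1]$ put $\sigma_\Lambda(f,\mathcal{I})=\sum_{k=1}^m\frac{|f(I_k)|}{\lambda_k}$. The $\Lambda$-variation of $f$ is $V_\Lambda(f)=\sup_{\mathcal{I}}\sigma_\Lambda(f,\mathcal{I})\in[0,\infty]$, the supremum being over all such finite sequences. $\Lambda BV$ is the set of all $f:[0,1]\to\mathbb{R}$ with $V_\Lambda(f)<\infty$. For $f:[0,1]\to\mathbb{R}$ and $n\ge1$ the $n$-th Bernstein polynomial of $f$, viewed as a function on $[0,1]$, is $B_nf(x)=\sum_{k=0}^n f\left(\frac{k}{n}\right)\binom{n}{k}x^k(1-x)^{n-k}$. *)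

theory Defs
  imports "HOL-Analysis.Analysis"
begin

text \<open>Functions \<open>[0,1] \<rightarrow> \<real>\<close> are modelled as total functions on the reals; no definition
  below looks at values outside \<open>[0,1]\<close>. Sequences are indexed from 0: \<open>\<Lambda> k\<close> stands for
  \<open>\<lambda>\<^sub>k\<^sub>+\<^sub>1\<close>, and entry \<open>k\<close> of a list of intervals for \<open>I\<^sub>k\<^sub>+\<^sub>1\<close>.\<close>

text \<open>The reciprocals are positive, so their series diverges to infinity iff it is not summable.\<close>

definition Lambda_sequence :: "(nat \<Rightarrow> real) \<Rightarrow> bool" where
  "Lambda_sequence \<Lambda> \<longleftrightarrow> incseq \<Lambda> \<and> (\<forall>k. 0 < \<Lambda> k) \<and> \<not> summable (\<lambda>k. 1 / \<Lambda> k)"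

text \<open>A pair \<open>(a, b)\<close> encodes the closed interval \<open>[a, b]\<close>, taken to be nondegenerate. Degenerate
  intervals contribute 0 and only delay later terms, so allowing them would not change the
  variation.\<close>

definition interval01 :: "real \<times> real \<Rightarrow> bool" where
  "interval01 I \<longleftrightarrow> 0 \<le> fst I \<and> fst I < snd I \<and> snd I \<le> 1"

definition nonoverlapping :: "real \<times> real \<Rightarrow> real \<times> real \<Rightarrow> bool" where
  "nonoverlapping I J \<longleftrightarrow>
     {fst I..snd I} \<inter> {fst J..snd J} \<subseteq> {fst I, snd I} \<inter> {fst J, snd J}"

definition interval_sequences :: "(real \<times> real) list set" where
  "interval_sequences =
     {Is. (\<forall>I\<in>set Is. interval01 I) \<and>
          (\<forall>i<length Is. \<forall>j<length Is. i \<noteq> j \<longrightarrow> nonoverlapping (Is ! i) (Is ! j))}"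

definition Lambda_sum :: "(nat \<Rightarrow> real) \<Rightarrow> (real \<Rightarrow> real) \<Rightarrow> (real \<times> real) list \<Rightarrow> real" where
  "Lambda_sum \<Lambda> f Is = (\<Sum>k<length Is. \<bar>f (snd (Is ! k)) - f (fst (Is ! k))\<bar> / \<Lambda> k)"

definition Lambda_variation :: "(nat \<Rightarrow> real) \<Rightarrow> (real \<Rightarrow> real) \<Rightarrow> ereal" where
  "Lambda_variation \<Lambda> f = (SUP Is\<in>interval_sequences. ereal (Lambda_sum \<Lambda> f Is))"

definition Lambda_BV :: "(nat \<Rightarrow> real) \<Rightarrow> (real \<Rightarrow> real) set" where
  "Lambda_BV \<Lambda> = {f. Lambda_variation \<Lambda> f < \<infinity>}"

definition Bernstein_polynomial :: "nat \<Rightarrow> (real \<Rightarrow> real) \<Rightarrow> real \<Rightarrow> real" where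
  "Bernstein_polynomial n f x = (\<Sum>k\<le>n. f (real k / real n) * Bernstein n k x)"

end

theory Submission
  imports Defs
begin

text \<open>
  \<open>Bernstein_polynomial n f x\<close> is the expected value of \<open>f (S x / n)\<close>, where \<open>S x\<close> is a binomial
  random variable with parameters \<open>n\<close> and \<open>x\<close>. All these variables can be realised together: draw
  \<open>n\<close> independent uniform points of \<open>[0,1]\<close> and let \<open>S x\<close> count those that are at most \<open>x\<close>. In
  this coupling every outcome gives a nondecreasing function \<open>x \<mapsto> S x / n\<close> from \<open>[0,1]\<close> to itself,
  so the Bernstein polynomial is an average of functions \<open>f \<circ> g\<close> with \<open>g\<close> nondecreasing. Such a
  reparametrisation cannot increase the variation (\<open>Lambda_variation_comp_mono_le\<close>): it maps
  nonoverlapping intervals to nonoverlapping intervals, some of which may collapse to points, and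
  removing those only moves the remaining terms to denominators that are no larger. Since
  \<open>Lambda_sum\<close> is convex in the function (\<open>Lambda_sum_convex_combination_le\<close>), the average has no
  larger variation either.

  A given sequence of intervals has only finitely many endpoints, so the uniform points can be
  rounded up to the next element of a finite set \<open>P\<close> that contains these endpoints and \<open>1\<close>;
  this does not change the count \<open>S x\<close> at any \<open>x \<in> P\<close>. The outcomes are then words of
  length \<open>n\<close> over \<open>P\<close>, and all expectations are finite sums
  (\<open>sum_Bernstein_eq_sum_words\<close>).
\<close>

section \<open>Sequences of nonoverlapping intervals\<close>

lemma nonoverlapping_if_separated:
  assumes "fst I \<le> snd I" "fst J \<le> snd J" "snd I \<le> fst J \<or> snd J \<le> fst I"
  shows "nonoverlapping I J"
  using assms by (auto simp: nonoverlapping_def)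

text \<open>If two nondegenerate intervals are not separated, then the midpoint of their intersection is
  interior to both.\<close>

lemma separated_if_nonoverlapping:
  assumes "interval01 I" "interval01 J" "nonoverlapping I J"
  shows "snd I \<le> fst J \<or> snd J \<le> fst I"
proof (rule ccontr)
  assume not_separated: "\<not> ?thesis"
  define m where "m = (max (fst I) (fst J) + min (snd I) (snd J)) / 2"
  have "max (fst I) (fst J) < min (snd I) (snd J)"
    using not_separated assms(1,2) by (simp add: interval01_def)
  then have "max (fst I) (fst J) < m" "m < min (snd I) (snd J)"
    by (auto simp only: m_def less_divide_eq_numeral1 divide_less_eq_numeral1 mult_2_right
        add_less_cancel_left add_less_cancel_right)
  then have m: "fst I < m" "m < snd I" "fst J < m" "m < snd J"
    by simp_all
  then have "m \<in> {fst I..snd I} \<inter> {fst J..snd J}"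
    by simp
  with assms(3) have "m \<in> {fst I, snd I}"
    unfolding nonoverlapping_def by blast
  with m show False by simp
qed

text \<open>Separation is symmetric, so the condition on all pairs of positions can be stated with
  \<open>sorted_wrt\<close>, which is compatible with \<open>map\<close> and \<open>filter\<close>.\<close>

lemma interval_sequences_iff_sorted_wrt:
  "Is \<in> interval_sequences \<longleftrightarrow>
     (\<forall>I\<in>set Is. interval01 I) \<and>
     sorted_wrt (\<lambda>I J. snd I \<le> fst J \<or> snd J \<le> fst I) Is"
  (is "_ \<longleftrightarrow> ?valid \<and> ?separated")
proof (cases ?valid)
  case True
  have "nonoverlapping (Is ! i) (Is ! j) \<longleftrightarrow>
      snd (Is ! i) \<le> fst (Is ! j) \<or> snd (Is ! j) \<le> fst (Is ! i)"
    if "i < length Is" "j < length Is" for i j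
    using True that nonoverlapping_if_separated separated_if_nonoverlapping
    by (metis interval01_def less_imp_le nth_mem)
  then have "Is \<in> interval_sequences \<longleftrightarrow>
      (\<forall>i<length Is. \<forall>j<length Is. i \<noteq> j \<longrightarrow>
         snd (Is ! i) \<le> fst (Is ! j) \<or> snd (Is ! j) \<le> fst (Is ! i))"
    using True by (auto simp: interval_sequences_def)
  also have "\<dots> \<longleftrightarrow> ?separated"
  proof
    assume separated: ?separated
    show "\<forall>i<length Is. \<forall>j<length Is. i \<noteq> j \<longrightarrow>
        snd (Is ! i) \<le> fst (Is ! j) \<or> snd (Is ! j) \<le> fst (Is ! i)"
    proof (intro allI impI)
      fix i j assume "i < length Is" "j < length Is" "i \<noteq> j"
      then consider "i < j" "j < length Is" | "j < i" "i < length Is"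
        by linarith
      then show "snd (Is ! i) \<le> fst (Is ! j) \<or> snd (Is ! j) \<le> fst (Is ! i)"
        by cases (use sorted_wrt_nth_less[OF separated] in blast)+
    qed
  qed (simp add: sorted_wrt_iff_nth_less)
  finally show ?thesis using True by simp
qed (auto simp: interval_sequences_def)

section \<open>Monotone reparametrisation\<close>

lemma Lambda_sum_snoc:
  "Lambda_sum \<Lambda> f (Is @ [I]) =
     Lambda_sum \<Lambda> f Is + \<bar>f (snd I) - f (fst I)\<bar> / \<Lambda> (length Is)"
  by (simp add: Lambda_sum_def nth_append)

lemma Lambda_sum_map:
  "Lambda_sum \<Lambda> f (map (\<lambda>I. (g (fst I), g (snd I))) Is) = Lambda_sum \<Lambda> (f \<circ> g) Is"
  by (simp add: Lambda_sum_def)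

text \<open>A degenerate interval contributes nothing, and without it every later term is divided by an
  earlier, hence no larger, entry of \<open>\<Lambda>\<close>.\<close>

lemma Lambda_sum_le_filter_nondegenerate:
  assumes "incseq \<Lambda>" "\<And>k. 0 < \<Lambda> k"
  shows "Lambda_sum \<Lambda> f Is \<le> Lambda_sum \<Lambda> f (filter (\<lambda>I. fst I \<noteq> snd I) Is)"
proof (induction Is rule: rev_induct)
  case (snoc I Is)
  let ?Js = "filter (\<lambda>I. fst I \<noteq> snd I) Is"
  have "\<Lambda> (length ?Js) \<le> \<Lambda> (length Is)"
    using assms(1) by (simp add: incseqD)
  then have "\<bar>f (snd I) - f (fst I)\<bar> / \<Lambda> (length Is) \<le> \<bar>f (snd I) - f (fst I)\<bar> / \<Lambda> (length ?Js)"
    using assms(2) by (intro divide_left_mono mult_pos_pos) auto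
  then show ?case
    using snoc.IH by (auto simp: Lambda_sum_snoc)
qed simp

lemma Lambda_variation_comp_mono_le:
  assumes "incseq \<Lambda>" "\<And>k. 0 < \<Lambda> k"
    and mono: "mono_on {0..1} g" and range: "g ` {0..1} \<subseteq> {0..1}"
  shows "Lambda_variation \<Lambda> (f \<circ> g) \<le> Lambda_variation \<Lambda> f"
  unfolding Lambda_variation_def
proof (rule SUP_mono)
  fix Is assume Is: "Is \<in> interval_sequences"
  let ?img = "\<lambda>I. (g (fst I), g (snd I))"
  define Js where "Js = filter (\<lambda>I. fst I \<noteq> snd I) (map ?img Is)"
  have valid: "interval01 I" if "I \<in> set Is" for I
    using Is that by (simp add: interval_sequences_iff_sorted_wrt)
  have g_le: "g x \<le> g y" if "0 \<le> x" "x \<le> y" "y \<le> 1" for x y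
    using that by (intro mono_onD[OF mono]) auto
  have "sorted_wrt (\<lambda>I J. snd I \<le> fst J \<or> snd J \<le> fst I) Is"
    using Is by (simp add: interval_sequences_iff_sorted_wrt)
  then have "sorted_wrt (\<lambda>I J. g (snd I) \<le> g (fst J) \<or> g (snd J) \<le> g (fst I)) Is"
  proof (rule sorted_wrt_mono_rel[rotated])
    fix I J assume "I \<in> set Is" "J \<in> set Is" "snd I \<le> fst J \<or> snd J \<le> fst I"
    then show "g (snd I) \<le> g (fst J) \<or> g (snd J) \<le> g (fst I)"
      using valid[of I] valid[of J] by (auto simp: interval01_def intro!: g_le)
  qed
  then have "sorted_wrt (\<lambda>I J. snd I \<le> fst J \<or> snd J \<le> fst I) Js"
    unfolding Js_def by (intro sorted_wrt_filter) (simp add: sorted_wrt_map)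
  moreover have "interval01 J" if J: "J \<in> set Js" for J
  proof -
    obtain I where I: "I \<in> set Is" "J = ?img I" and "g (fst I) \<noteq> g (snd I)"
      using J by (auto simp: Js_def)
    moreover have "g (fst I) \<in> {0..1}" "g (snd I) \<in> {0..1}"
      using range valid[OF I(1)] by (auto simp: interval01_def image_subset_iff)
    moreover have "g (fst I) \<le> g (snd I)"
      using valid[OF I(1)] by (intro g_le) (auto simp: interval01_def)
    ultimately show ?thesis
      by (simp add: interval01_def)
  qed
  ultimately have "Js \<in> interval_sequences"
    by (simp add: interval_sequences_iff_sorted_wrt)
  moreover have "Lambda_sum \<Lambda> (f \<circ> g) Is \<le> Lambda_sum \<Lambda> f Js"
    using Lambda_sum_le_filter_nondegenerate[OF assms(1,2)]
    by (metis Js_def Lambda_sum_map)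
  ultimately show "\<exists>Js\<in>interval_sequences.
      ereal (Lambda_sum \<Lambda> (f \<circ> g) Is) \<le> ereal (Lambda_sum \<Lambda> f Js)"
    by auto
qed

section \<open>Averages of functions\<close>

lemma Lambda_sum_cong:
  assumes "\<And>I. I \<in> set Is \<Longrightarrow> f (fst I) = g (fst I) \<and> f (snd I) = g (snd I)"
  shows "Lambda_sum \<Lambda> f Is = Lambda_sum \<Lambda> g Is"
  using assms by (simp add: Lambda_sum_def)

lemma Lambda_sum_convex_combination_le:
  assumes "\<And>k. 0 < \<Lambda> k" "\<And>w. w \<in> W \<Longrightarrow> 0 \<le> c w"
  shows "Lambda_sum \<Lambda> (\<lambda>x. \<Sum>w\<in>W. c w * F w x) Is \<le> (\<Sum>w\<in>W. c w * Lambda_sum \<Lambda> (F w) Is)"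
proof -
  let ?D = "\<lambda>w k. F w (snd (Is ! k)) - F w (fst (Is ! k))"
  have "Lambda_sum \<Lambda> (\<lambda>x. \<Sum>w\<in>W. c w * F w x) Is
      = (\<Sum>k<length Is. \<bar>\<Sum>w\<in>W. c w * ?D w k\<bar> / \<Lambda> k)"
    by (simp add: Lambda_sum_def right_diff_distrib sum_subtractf)
  also have "\<dots> \<le> (\<Sum>k<length Is. (\<Sum>w\<in>W. c w * \<bar>?D w k\<bar>) / \<Lambda> k)"
  proof (intro sum_mono divide_right_mono)
    fix k
    have "\<bar>\<Sum>w\<in>W. c w * ?D w k\<bar> \<le> (\<Sum>w\<in>W. \<bar>c w * ?D w k\<bar>)"
      by (rule sum_abs)
    also have "\<dots> = (\<Sum>w\<in>W. c w * \<bar>?D w k\<bar>)"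
      using assms(2) by (simp add: abs_mult)
    finally show "\<bar>\<Sum>w\<in>W. c w * ?D w k\<bar> \<le> (\<Sum>w\<in>W. c w * \<bar>?D w k\<bar>)" .
    show "0 \<le> \<Lambda> k"
      using assms(1) less_imp_le by blast
  qed
  also have "\<dots> = (\<Sum>w\<in>W. c w * Lambda_sum \<Lambda> (F w) Is)"
    unfolding Lambda_sum_def sum_divide_distrib sum_distrib_left times_divide_eq_right
    by (rule sum.swap)
  finally show ?thesis .
qed

section \<open>Binomial counts from a single random word\<close>

text \<open>Each point receives its distance from the preceding point, or from \<open>0\<close>. When
  \<open>1 \<in> P \<subseteq> {0..1}\<close>, this is the distribution of a uniform point of \<open>[0,1]\<close> after rounding up to
  the next element of \<open>P\<close>.\<close>

lemma ex_weights_with_uniform_cdf: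
  fixes P :: "real set"
  assumes "finite P" "P \<subseteq> {0..}"
  shows "\<exists>p. (\<forall>u\<in>P. 0 \<le> p u) \<and> (\<forall>x\<in>P. (\<Sum>u\<in>{u\<in>P. u \<le> x}. p u) = x)"
  using assms
proof (induction P rule: finite_linorder_max_induct)
  case (insert b A)
  then obtain p where p: "\<And>u. u \<in> A \<Longrightarrow> 0 \<le> p u"
    and cdf: "\<And>x. x \<in> A \<Longrightarrow> (\<Sum>u\<in>{u\<in>A. u \<le> x}. p u) = x"
    by (metis insert_subset)
  have A_less: "u < b" if "u \<in> A" for u
    using insert.hyps that by auto
  have sum_A_le: "sum p A \<le> b"
  proof (cases "A = {}")
    case False
    then have "{u \<in> A. u \<le> Max A} = A" "Max A \<in> A"
      using insert.hyps(1) by auto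
    then show ?thesis
      using cdf[of "Max A"] A_less[of "Max A"] by simp
  qed (use insert.prems in simp)
  define q where "q = p(b := b - sum p A)"
  have "b \<notin> A" using A_less by blast
  then have q_eq_p: "sum q B = sum p B" if "B \<subseteq> A" for B
    using that by (intro sum.cong) (auto simp: q_def)
  have "(\<Sum>u\<in>{u\<in>insert b A. u \<le> x}. q u) = x" if "x \<in> insert b A" for x
  proof (cases "x = b")
    case True
    then have "{u\<in>insert b A. u \<le> x} = insert b A"
      using A_less by fastforce
    then show ?thesis
      using \<open>b \<notin> A\<close> insert.hyps(1) True q_eq_p[of A] by (simp add: q_def)
  next
    case False
    then have "x \<in> A" using that by simp
    moreover from this have "{u\<in>insert b A. u \<le> x} = {u\<in>A. u \<le> x}"
      using A_less[of x] by auto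
    ultimately show ?thesis
      using q_eq_p[of "{u\<in>A. u \<le> x}"] cdf by simp
  qed
  moreover have "0 \<le> q u" if "u \<in> insert b A" for u
    using that p sum_A_le by (auto simp: q_def)
  ultimately show ?case by blast
qed simp

lemma Bernstein_Suc_0: "Bernstein (Suc n) 0 x = (1 - x) * Bernstein n 0 x"
  by (simp add: Bernstein_def)

lemma Bernstein_Suc_Suc:
  "Bernstein (Suc n) (Suc k) x = x * Bernstein n k x + (1 - x) * Bernstein n (Suc k) x"
proof (cases "Suc k \<le> n")
  case True
  then have "n - k = Suc (n - Suc k)" by simp
  then show ?thesis
    by (simp add: Bernstein_def algebra_simps)
qed (auto simp: Bernstein_def not_le less_Suc_eq_le binomial_eq_0)

text \<open>Conditioning on one of \<open>n + 1\<close> independent trials.\<close>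

lemma sum_Bernstein_Suc:
  "(\<Sum>k\<le>Suc n. h k * Bernstein (Suc n) k x) =
     x * (\<Sum>k\<le>n. h (Suc k) * Bernstein n k x) + (1 - x) * (\<Sum>k\<le>n. h k * Bernstein n k x)"
proof -
  have "(\<Sum>k\<le>n. h k * Bernstein n k x) = (\<Sum>k\<le>Suc n. h k * Bernstein n k x)"
    by (simp add: Bernstein_def)
  also have "\<dots> = h 0 * Bernstein n 0 x + (\<Sum>k\<le>n. h (Suc k) * Bernstein n (Suc k) x)"
    by (rule sum.atMost_Suc_shift)
  finally have shift: "(\<Sum>k\<le>n. h k * Bernstein n k x) =
      h 0 * Bernstein n 0 x + (\<Sum>k\<le>n. h (Suc k) * Bernstein n (Suc k) x)" .
  have "(\<Sum>k\<le>n. h (Suc k) * (x * Bernstein n k x + (1 - x) * Bernstein n (Suc k) x)) =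
      x * (\<Sum>k\<le>n. h (Suc k) * Bernstein n k x)
      + (1 - x) * (\<Sum>k\<le>n. h (Suc k) * Bernstein n (Suc k) x)"
    by (simp only: distrib_left sum.distrib sum_distrib_left mult.left_commute)
  then show ?thesis
    unfolding sum.atMost_Suc_shift Bernstein_Suc_0 Bernstein_Suc_Suc shift
    by (simp only: distrib_left mult.left_commute add.left_commute)
qed

lemma sum_words_Suc:
  "(\<Sum>ws | set ws \<subseteq> P \<and> length ws = Suc n. H ws) =
     (\<Sum>u\<in>P. \<Sum>ws | set ws \<subseteq> P \<and> length ws = n. H (u # ws))"
proof -
  let ?W = "{ws. set ws \<subseteq> P \<and> length ws = n}"
  have "{ws. set ws \<subseteq> P \<and> length ws = Suc n} = (\<lambda>(u, ws). u # ws) ` (P \<times> ?W)"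
    by (force simp: length_Suc_conv)
  moreover have "inj_on (\<lambda>(u, ws). u # ws) (P \<times> ?W)"
    by (auto simp: inj_on_def)
  ultimately show ?thesis
    by (simp add: sum.reindex sum.cartesian_product split_def)
qed

text \<open>The number of letters that are at most \<open>x\<close> in a word of \<open>n\<close> independent letters with
  distribution \<open>p\<close> is binomial with parameters \<open>n\<close> and \<open>x\<close>. The word does not depend on \<open>x\<close>: this
  is the coupling of all these distributions.\<close>

lemma sum_Bernstein_eq_sum_words:
  assumes "finite P" and total: "sum p P = 1" and cdf: "(\<Sum>u\<in>{u\<in>P. u \<le> x}. p u) = x"
  shows "(\<Sum>k\<le>n. h k * Bernstein n k x) =
    (\<Sum>ws | set ws \<subseteq> P \<and> length ws = n.
       prod_list (map p ws) * h (length (filter (\<lambda>u. u \<le> x) ws)))"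
proof (induction n arbitrary: h)
  case 0
  have "{ws. set ws \<subseteq> P \<and> length ws = 0} = {[]}" by auto
  then show ?case by (simp add: Bernstein_def)
next
  case (Suc n)
  let ?E = "\<lambda>h. \<Sum>ws | set ws \<subseteq> P \<and> length ws = n.
    prod_list (map p ws) * h (length (filter (\<lambda>u. u \<le> x) ws))"
  have "sum p P = sum p {u\<in>P. u \<le> x} + sum p {u\<in>P. \<not> u \<le> x}"
    using assms(1) by (subst sum.union_disjoint[symmetric]) (auto intro!: sum.cong)
  then have not_cdf: "sum p {u\<in>P. \<not> u \<le> x} = 1 - x"
    using total cdf by simp
  have "(\<Sum>ws | set ws \<subseteq> P \<and> length ws = Suc n.
        prod_list (map p ws) * h (length (filter (\<lambda>u. u \<le> x) ws)))
      = (\<Sum>u\<in>P. if u \<le> x then p u * ?E (\<lambda>k. h (Suc k)) else p u * ?E h)"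
    unfolding sum_words_Suc by (intro sum.cong) (auto simp: sum_distrib_left mult.assoc)
  also have "\<dots> = x * ?E (\<lambda>k. h (Suc k)) + (1 - x) * ?E h"
    using assms(1) cdf not_cdf by (simp add: sum.If_cases Int_def flip: sum_distrib_right)
  also have "\<dots> = (\<Sum>k\<le>Suc n. h k * Bernstein (Suc n) k x)"
    by (simp only: sum_Bernstein_Suc Suc.IH)
  finally show ?case ..
qed

section \<open>Bernstein polynomials diminish the variation\<close>

theorem theorem1:
  fixes \<Lambda> :: "nat \<Rightarrow> real" and f :: "real \<Rightarrow> real" and n :: nat
  assumes "Lambda_sequence \<Lambda>"
    and "f \<in> Lambda_BV \<Lambda>"
    and "n \<ge> 1"
  shows "Lambda_variation \<Lambda> (Bernstein_polynomial n f) \<le> Lambda_variation \<Lambda> f"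
  unfolding Lambda_variation_def[of _ "Bernstein_polynomial n f"]
proof (rule SUP_least)
  fix Is assume Is: "Is \<in> interval_sequences"
  have inc: "incseq \<Lambda>" and pos: "0 < \<Lambda> k" for k
    using assms(1) by (auto simp: Lambda_sequence_def)
  have "[] \<in> interval_sequences"
    by (simp add: interval_sequences_def)
  then have "ereal (Lambda_sum \<Lambda> f []) \<le> Lambda_variation \<Lambda> f"
    unfolding Lambda_variation_def by (rule SUP_upper)
  then obtain v where v: "Lambda_variation \<Lambda> f = ereal v"
    using assms(2) by (cases "Lambda_variation \<Lambda> f") (auto simp: Lambda_BV_def)

  \<comment> \<open>The point 1 makes the total weight equal to 1.\<close>
  define P where "P = insert 1 (fst ` set Is \<union> snd ` set Is)"
  have "finite P" by (simp add: P_def)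
  have P01: "P \<subseteq> {0..1}"
    using Is by (fastforce simp: P_def interval_sequences_def interval01_def)
  then obtain p where p_nonneg: "\<And>u. u \<in> P \<Longrightarrow> 0 \<le> p u"
    and cdf: "\<And>x. x \<in> P \<Longrightarrow> (\<Sum>u\<in>{u\<in>P. u \<le> x}. p u) = x"
    using ex_weights_with_uniform_cdf[OF \<open>finite P\<close>] by fastforce
  have "{u\<in>P. u \<le> 1} = P" using P01 by auto
  then have total: "sum p P = 1"
    using cdf[of 1] by (simp add: P_def)

  define W where "W = {ws. set ws \<subseteq> P \<and> length ws = n}"
  define weight where "weight ws = prod_list (map p ws)" for ws
  define g where "g ws x = real (length (filter (\<lambda>u. u \<le> x) ws)) / real n" for ws and x :: real
  have weight_nonneg: "0 \<le> weight ws" if "ws \<in> W" for ws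
    using that p_nonneg unfolding weight_def W_def by (intro prod_list_nonneg) auto
  \<comment> \<open>The case of a constant function: the Bernstein basis sums to 1.\<close>
  have weight_total: "sum weight W = 1"
    using sum_Bernstein_eq_sum_words[OF \<open>finite P\<close> total cdf[of 1], where n = n and h = "\<lambda>_. 1"]
    by (simp add: P_def W_def weight_def)

  have "Lambda_sum \<Lambda> (Bernstein_polynomial n f) Is
      = Lambda_sum \<Lambda> (\<lambda>x. \<Sum>ws\<in>W. weight ws * (f \<circ> g ws) x) Is"
  proof -
    have "Bernstein_polynomial n f x = (\<Sum>ws\<in>W. weight ws * (f \<circ> g ws) x)" if "x \<in> P" for x
      using sum_Bernstein_eq_sum_words[OF \<open>finite P\<close> total cdf[OF that],
          where n = n and h = "\<lambda>k. f (real k / real n)"]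
      by (simp add: Bernstein_polynomial_def W_def weight_def g_def)
    then show ?thesis
      by (intro Lambda_sum_cong) (auto simp: P_def)
  qed
  also have "\<dots> \<le> (\<Sum>ws\<in>W. weight ws * Lambda_sum \<Lambda> (f \<circ> g ws) Is)"
    using pos weight_nonneg by (rule Lambda_sum_convex_combination_le)
  also have "\<dots> \<le> (\<Sum>ws\<in>W. weight ws * v)"
  proof (intro sum_mono mult_left_mono)
    fix ws assume ws: "ws \<in> W"
    have "mono_on {0..1} (g ws)"
    proof (rule mono_onI)
      fix x y :: real assume "x \<le> y"
      then have "filter (\<lambda>u. u \<le> x) (filter (\<lambda>u. u \<le> y) ws) = filter (\<lambda>u. u \<le> x) ws"
        unfolding filter_filter by (intro filter_cong) auto
      moreover have "length (filter (\<lambda>u. u \<le> x) (filter (\<lambda>u. u \<le> y) ws))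
          \<le> length (filter (\<lambda>u. u \<le> y) ws)"
        by (rule length_filter_le)
      ultimately show "g ws x \<le> g ws y"
        by (simp add: g_def divide_right_mono)
    qed
    moreover have "g ws ` {0..1} \<subseteq> {0..1}"
      using ws by (auto simp: W_def g_def divide_le_eq_1)
    ultimately have "Lambda_variation \<Lambda> (f \<circ> g ws) \<le> ereal v"
      using Lambda_variation_comp_mono_le[OF inc pos] v by metis
    moreover have "ereal (Lambda_sum \<Lambda> (f \<circ> g ws) Is) \<le> Lambda_variation \<Lambda> (f \<circ> g ws)"
      unfolding Lambda_variation_def using Is by (rule SUP_upper)
    ultimately have "ereal (Lambda_sum \<Lambda> (f \<circ> g ws) Is) \<le> ereal v"
      by (rule order_trans[rotated])
    then show "Lambda_sum \<Lambda> (f \<circ> g ws) Is \<le> v" by simp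
  qed (rule weight_nonneg)
  also have "\<dots> = v"
    using weight_total by (simp flip: sum_distrib_right)
  finally show "ereal (Lambda_sum \<Lambda> (Bernstein_polynomial n f) Is) \<le> Lambda_variation \<Lambda> f"
    by (simp add: v)
qed

end
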